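(* For any one-dimensional nonlinear problem $\mathcal{L}(u)=f$ such that $$\text{DtN}_1'(\lambda_{\text{ex}},\psi_1)\cdot \text{DtN}_2'(\lambda_{\text{ex}},\psi_2)>0,\qquad \lambda_{\text{ex}}:=u_{\text{ex}}|_{\Gamma},$$ where $u_{\text{ex}}$ is the exact solution and $'$ denotes the derivative with respect to the first argument, there exists a $\theta\in(0,1)$ such that the nonlinear Dirichlet-Neumann method $$\lambda^n=G(\lambda^{n-1}):=(1-\theta)\lambda^{n-1}+\theta\,\text{NtD}_2\left(-\text{DtN}_1(\lambda^{n-1},\psi_1),\psi_2\right),\qquad n\ge 1,$$ converges quadratically.
   Context: Setting. $\Omega\subset\mathbb{R}$ is an open bounded interval, $f,g$ are given data, and $\mathcal{L}$ is a nonlinear differential operator such that the boundary value problem $\mathcal{L}(u)=f$ in $\Omega$, $u=g$ on $\partial\Omega$ admits a unique weak solution $u_{\text{ex}}$ in a Hilbert space $\mathcal{X}$ (e.g. $H^1(\Omega)$). $\Omega$ is divided into two nonoverlapping subdomains $\Omega_1,\Omega_2$ with interface point $\Gamma=\partial\Omega_j\setminus\partial\Omega$. Put $f_j:=f|_{\Omega_j}$, $g_j:=g|_{\partial\Omega_j\setminus\Gamma}$ and $\psi_j:=(f_j,g_j)$ for $j=1,2$. Neumann operators. $\mathcal{N}_j$ denotes the outward nonlinear Neumann (flux) condition at $\Gamma$ for the subdomain $\Omega_j$, as found through integration by parts of the variational formulation of the PDE; $\mathcal{N}_ju$ is assumed to define a bounded linear functional over $\mathcal{X}$ (for the well-posedness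 of the Dirichlet-Neumann method). For example, if $\mathcal{L}(u)=-\partial_x((1+\alpha u^2)\partial_x u)$ then $\mathcal{N}_ju=(-1)^{j+1}(1+\alpha u_{|\Gamma}^2)\,\partial_xu_{|\Gamma}$. Nonlinear Dirichlet-to-Neumann and Neumann-to-Dirichlet operators. $\text{DtN}_j(\lambda,\psi_j):=\mathcal{N}_ju_j$, where $u_j$ solves $$\mathcal{L}(u_j)=f_j\ \text{in }\Omega_j,\quad u_j=g_j\ \text{on }\partial\Omega_j\setminus\Gamma,\quad u_j=\lambda\ \text{on }\Gamma;$$ $\text{NtD}_j(\phi,\psi_j):=v_j|_\Gamma$, where $v_j$ solves $$\mathcal{L}(v_j)=f_j\ \text{in }\Omega_j,\quad v_j=g_j\ \text{on }\partial\Omega_j\setminus\Gamma,\quad \mathcal{N}_jv_j=\phi\ \text{on }\Gamma.$$ For fixed $\psi_j$, the operators $\text{DtN}_j(\cdot,\psi_j)$ and $\text{NtD}_j(\cdot,\psi_j)$ are inverse to each other. In the one-dimensional case they are real functions of one real variable. The number $\theta\in(0,1)$ is the relaxation parameter of the method, and the iteration starts from an initial guess $\lambda^0$.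
   Formalization: The formal theorem additionally assumes that DtN_1 and DtN_2 are twice differentiable at λ_ex (differentiable nearby, with derivative differentiable at λ_ex); with first derivatives only, convergence may be merely superlinear. Convergence is for λ^0 close to λ_ex. *)

theory Defs
  imports "HOL-Analysis.Analysis"
begin

text \<open>
  The Hilbert space \<open>\<X>\<close> is the type \<open>'x\<close>; an element \<open>u\<close> is realised as the function
  \<open>ev P u\<close> on the closed interval \<open>{lend P..rend P}\<close>, the closure of \<open>\<Omega>\<close> (in one dimension the
  functions are continuous, so the traces are point values).  The operator is given in weak form:
  \<open>wform P S u v\<close> stands for the pairing of \<open>\<L>(u)\<close> with the test function \<open>v\<close> after integration
  by parts over \<open>S\<close> without the boundary term, for instance the integral over \<open>S\<close> of
  \<open>(1 + \<alpha> u\<^sup>2) u' v'\<close> on \<open>H\<^sup>1(\<Omega>)\<close>.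
\<close>

record 'x dn_problem =
  lend :: real
  rend :: real
  iface :: real
  ev :: "'x \<Rightarrow> real \<Rightarrow> real"
  wform :: "real set \<Rightarrow> 'x \<Rightarrow> 'x \<Rightarrow> real"

datatype side = Sub1 | Sub2

type_synonym data = "(real \<Rightarrow> real) \<times> (real \<Rightarrow> real)"

definition dom :: "'x dn_problem \<Rightarrow> real set" where
  "dom P = {lend P<..<rend P}"

fun sub :: "'x dn_problem \<Rightarrow> side \<Rightarrow> real set" where
  "sub P Sub1 = {lend P<..<iface P}"
| "sub P Sub2 = {iface P<..<rend P}"

definition outer :: "'x dn_problem \<Rightarrow> side \<Rightarrow> real set" where
  "outer P j = frontier (sub P j) - {iface P}"

definition sub_data :: "'x dn_problem \<Rightarrow> (real \<Rightarrow> real) \<Rightarrow> (real \<Rightarrow> real) \<Rightarrow> side \<Rightarrow> data" where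
  "sub_data P f g j = (restrict f (sub P j), restrict g (outer P j))"

text \<open>
  Gluing two functions that agree at \<open>\<Gamma>\<close> must not leave \<open>\<X>\<close>, and the trace at \<open>\<Gamma>\<close> must not vanish
  on the space of functions with zero boundary values; both hold for \<open>H\<^sup>1(\<Omega>)\<close>.
\<close>

definition hilbert_function_space :: "'x::{real_inner,complete_space} dn_problem \<Rightarrow> bool" where
  "hilbert_function_space P \<longleftrightarrow>
     lend P < iface P \<and> iface P < rend P \<and>
     (\<forall>x\<in>closure (dom P). bounded_linear (\<lambda>u. ev P u x)) \<and>
     (\<forall>u. continuous_on (closure (dom P)) (ev P u)) \<and>
     (\<forall>u w. (\<forall>x\<in>closure (dom P). ev P u x = ev P w x) \<longrightarrow> u = w) \<and>
     (\<forall>u1 u2. ev P u1 (iface P) = ev P u2 (iface P) \<longrightarrow>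
        (\<exists>w. (\<forall>x\<in>closure (sub P Sub1). ev P w x = ev P u1 x) \<and>
             (\<forall>x\<in>closure (sub P Sub2). ev P w x = ev P u2 x))) \<and>
     (\<exists>v. (\<forall>x\<in>frontier (dom P). ev P v x = 0) \<and> ev P v (iface P) = 1)"

text \<open>
  The property of a differential operator that domain decomposition relies on is locality: on an open
  set, its weak form only sees the restrictions of \<open>u\<close> and \<open>v\<close> to that set, and the weak form over \<open>\<Omega>\<close>
  is the sum of those over the subdomains.  No linearity in \<open>u\<close> is imposed.
\<close>

definition local_operator :: "'x::{real_inner,complete_space} dn_problem \<Rightarrow> bool" where
  "local_operator P \<longleftrightarrow>
     (\<forall>S\<in>{dom P, sub P Sub1, sub P Sub2}.
        (\<forall>u. bounded_linear (wform P S u)) \<and>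
        (\<forall>u u' v v'. (\<forall>x\<in>S. ev P u x = ev P u' x) \<longrightarrow> (\<forall>x\<in>S. ev P v x = ev P v' x) \<longrightarrow>
           wform P S u v = wform P S u' v')) \<and>
     (\<forall>u v. wform P (dom P) u v = wform P (sub P Sub1) u v + wform P (sub P Sub2) u v)"

definition load :: "'x dn_problem \<Rightarrow> real set \<Rightarrow> (real \<Rightarrow> real) \<Rightarrow> 'x \<Rightarrow> real" where
  "load P S f v = (LINT x:S|lborel. f x * ev P v x)"

definition solves_in :: "'x dn_problem \<Rightarrow> real set \<Rightarrow> (real \<Rightarrow> real) \<Rightarrow> 'x \<Rightarrow> bool" where
  "solves_in P S f u \<longleftrightarrow>
     (\<forall>v. (\<forall>x\<in>frontier S. ev P v x = 0) \<longrightarrow> wform P S u v = load P S f v)"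

definition weak_solution ::
  "'x dn_problem \<Rightarrow> (real \<Rightarrow> real) \<Rightarrow> (real \<Rightarrow> real) \<Rightarrow> 'x \<Rightarrow> bool" where
  "weak_solution P f g u \<longleftrightarrow>
     solves_in P (dom P) f u \<and> (\<forall>x\<in>frontier (dom P). ev P u x = g x)"

definition u_ex :: "'x dn_problem \<Rightarrow> (real \<Rightarrow> real) \<Rightarrow> (real \<Rightarrow> real) \<Rightarrow> 'x" where
  "u_ex P f g = (THE u. weak_solution P f g u)"

definition lambda_ex :: "'x dn_problem \<Rightarrow> (real \<Rightarrow> real) \<Rightarrow> (real \<Rightarrow> real) \<Rightarrow> real" where
  "lambda_ex P f g = ev P (u_ex P f g) (iface P)"

text \<open>
  The outward flux at \<open>\<Gamma>\<close> of a function with \<open>\<L>(u) = f\<close> in the subdomain is the coefficient \<open>q\<close> of the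
  boundary term \<open>q v(\<Gamma>)\<close> left by integration by parts; \<open>v \<mapsto> q v(\<Gamma>)\<close> is the corresponding bounded
  linear functional on \<open>\<X>\<close>.  For \<open>\<L>(u) = - ((1 + \<alpha> u\<^sup>2) u')'\<close> this is \<open>(1 + \<alpha> u\<^sup>2) u'\<close> at \<open>\<Gamma>\<close> for the
  left subdomain and its negative for the right one.
\<close>

definition neumann :: "'x dn_problem \<Rightarrow> side \<Rightarrow> (real \<Rightarrow> real) \<Rightarrow> 'x \<Rightarrow> real" where
  "neumann P j f u =
     (THE q. \<forall>v. (\<forall>x\<in>outer P j. ev P v x = 0) \<longrightarrow>
        wform P (sub P j) u v = load P (sub P j) f v + q * ev P v (iface P))"

text \<open>
  A solution on a subdomain is represented by any of its extensions to \<open>\<Omega>\<close>, so uniqueness below means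
  uniqueness of the restriction to the closed subdomain.
\<close>

definition dirichlet_sol :: "'x dn_problem \<Rightarrow> side \<Rightarrow> real \<Rightarrow> data \<Rightarrow> 'x \<Rightarrow> bool" where
  "dirichlet_sol P j lam \<psi> u \<longleftrightarrow>
     solves_in P (sub P j) (fst \<psi>) u \<and> (\<forall>x\<in>outer P j. ev P u x = snd \<psi> x) \<and>
     ev P u (iface P) = lam"

definition neumann_sol :: "'x dn_problem \<Rightarrow> side \<Rightarrow> real \<Rightarrow> data \<Rightarrow> 'x \<Rightarrow> bool" where
  "neumann_sol P j \<phi> \<psi> u \<longleftrightarrow>
     solves_in P (sub P j) (fst \<psi>) u \<and> (\<forall>x\<in>outer P j. ev P u x = snd \<psi> x) \<and>
     neumann P j (fst \<psi>) u = \<phi>"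

definition DtN :: "'x dn_problem \<Rightarrow> side \<Rightarrow> real \<Rightarrow> data \<Rightarrow> real" where
  "DtN P j lam \<psi> = (THE q. \<exists>u. dirichlet_sol P j lam \<psi> u \<and> neumann P j (fst \<psi>) u = q)"

definition NtD :: "'x dn_problem \<Rightarrow> side \<Rightarrow> real \<Rightarrow> data \<Rightarrow> real" where
  "NtD P j \<phi> \<psi> = (THE lam. \<exists>v. neumann_sol P j \<phi> \<psi> v \<and> ev P v (iface P) = lam)"

definition unique_on :: "'x dn_problem \<Rightarrow> real set \<Rightarrow> ('x \<Rightarrow> bool) \<Rightarrow> bool" where
  "unique_on P S Q \<longleftrightarrow>
     (\<exists>u. Q u) \<and> (\<forall>u w. Q u \<longrightarrow> Q w \<longrightarrow> (\<forall>x\<in>closure S. ev P u x = ev P w x))"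

definition well_posed :: "'x dn_problem \<Rightarrow> (real \<Rightarrow> real) \<Rightarrow> (real \<Rightarrow> real) \<Rightarrow> bool" where
  "well_posed P f g \<longleftrightarrow>
     set_integrable lborel (dom P) f \<and>
     (\<exists>!u. weak_solution P f g u) \<and>
     (\<forall>j lam. unique_on P (sub P j) (dirichlet_sol P j lam (sub_data P f g j))) \<and>
     (\<forall>j \<phi>. unique_on P (sub P j) (neumann_sol P j \<phi> (sub_data P f g j)))"

definition DN_map ::
  "'x dn_problem \<Rightarrow> (real \<Rightarrow> real) \<Rightarrow> (real \<Rightarrow> real) \<Rightarrow> real \<Rightarrow> real \<Rightarrow> real" where
  "DN_map P f g \<theta> lam =
     (1 - \<theta>) * lam +
     \<theta> * NtD P Sub2 (- DtN P Sub1 lam (sub_data P f g Sub1)) (sub_data P f g Sub2)"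

definition twice_differentiable_at :: "(real \<Rightarrow> real) \<Rightarrow> real \<Rightarrow> bool" where
  "twice_differentiable_at h x \<longleftrightarrow>
     (\<forall>\<^sub>F y in nhds x. h differentiable (at y)) \<and> deriv h differentiable (at x)"

text \<open>
  Convergence of a fixed-point iteration is local: the initial guess is taken close enough to the limit.
\<close>

definition converges_quadratically_to :: "(real \<Rightarrow> real) \<Rightarrow> real \<Rightarrow> bool" where
  "converges_quadratically_to G l \<longleftrightarrow>
     (\<exists>\<epsilon>>0. \<exists>C. \<forall>lam0. \<bar>lam0 - l\<bar> < \<epsilon> \<longrightarrow>
        (\<lambda>n. (G ^^ n) lam0) \<longlonglongrightarrow> l \<and>
        (\<forall>n. \<bar>(G ^^ Suc n) lam0 - l\<bar> \<le> C * \<bar>(G ^^ n) lam0 - l\<bar>\<^sup>2))"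

end

theory Submission
  imports Defs
begin

text \<open>
  Write \<open>D\<^sub>j\<close> for \<open>DtN\<^sub>j(\<cdot>, \<psi>\<^sub>j)\<close> and \<open>l\<close> for \<open>\<lambda>\<^sub>e\<^sub>x\<close>.  Testing the equation on \<open>\<Omega>\<close> shows that the two
  outward fluxes of the exact solution cancel, \<open>D\<^sub>1(l) + D\<^sub>2(l) = 0\<close>, and since \<open>NtD\<^sub>2\<close> inverts \<open>D\<^sub>2\<close>, the
  trace \<open>l\<close> is a fixed point of \<open>G\<close> with \<open>G'(l) = 1 - \<theta> - \<theta> D\<^sub>1'(l) / D\<^sub>2'(l)\<close>.  As both derivatives have
  the same sign, \<open>\<theta> = D\<^sub>2'(l) / (D\<^sub>1'(l) + D\<^sub>2'(l))\<close> lies in \<open>(0, 1)\<close> and makes \<open>G'(l)\<close> vanish.  By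
  the inverse function theorem \<open>G\<close> is again twice differentiable at \<open>l\<close>, so \<open>G'(x) = O(x - l)\<close>, and the
  mean value theorem bounds \<open>G(x) - l\<close> by a multiple of \<open>(x - l)\<^sup>2\<close>.
\<close>

section \<open>Calculus of functions that are twice differentiable at a point\<close>

lemma twice_differentiable_atI:
  assumes "\<forall>\<^sub>F y in nhds x. (h has_real_derivative h' y) (at y)"
    and "h' differentiable (at x)"
  shows "twice_differentiable_at h x"
proof -
  have "\<forall>\<^sub>F y in nhds x. h differentiable (at y)"
    using assms(1) by eventually_elim (auto simp: real_differentiable_def)
  moreover have "\<forall>\<^sub>F y in nhds x. deriv h y = h' y"
    using assms(1) by eventually_elim (rule DERIV_imp_deriv)
  then have "deriv h differentiable (at x)"
    using assms(2) by (auto simp: real_differentiable_def DERIV_cong_ev[OF refl])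
  ultimately show ?thesis
    by (simp add: twice_differentiable_at_def)
qed

lemma twice_differentiable_atD:
  assumes "twice_differentiable_at h x"
  shows "\<forall>\<^sub>F y in nhds x. (h has_real_derivative deriv h y) (at y)"
    and "(h has_real_derivative deriv h x) (at x)"
    and "deriv h differentiable (at x)"
proof -
  show *: "\<forall>\<^sub>F y in nhds x. (h has_real_derivative deriv h y) (at y)"
    using assms by (auto simp: twice_differentiable_at_def DERIV_deriv_iff_real_differentiable)
  show "(h has_real_derivative deriv h x) (at x)"
    using eventually_nhds_x_imp_x[OF *] .
  show "deriv h differentiable (at x)"
    using assms by (simp add: twice_differentiable_at_def)
qed

lemma eventually_nhds_isCont:
  assumes "isCont h x" and "\<forall>\<^sub>F y in nhds (h x). Q y"
  shows "\<forall>\<^sub>F y in nhds x. Q (h y)"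
  using assms eventually_compose_filterlim
  unfolding isCont_def tendsto_at_iff_tendsto_nhds by blast

lemma twice_differentiable_at_compose:
  assumes "twice_differentiable_at h x" and "twice_differentiable_at k (h x)"
  shows "twice_differentiable_at (\<lambda>y. k (h y)) x"
proof (rule twice_differentiable_atI)
  note h = twice_differentiable_atD[OF assms(1)] and k = twice_differentiable_atD[OF assms(2)]
  \<comment> \<open>Continuity of \<open>h\<close> pulls the neighbourhood of \<open>h x\<close> on
    which \<open>k\<close> is differentiable back to a neighbourhood of \<open>x\<close>.\<close>
  have "\<forall>\<^sub>F y in nhds x. (k has_real_derivative deriv k (h y)) (at (h y))"
    using DERIV_isCont[OF h(2)] k(1) by (rule eventually_nhds_isCont)
  with h(1) show "\<forall>\<^sub>F y in nhds x.
      ((\<lambda>y. k (h y)) has_real_derivative deriv k (h y) * deriv h y) (at y)"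
    by eventually_elim (rule DERIV_chain2)
  obtain d e where "(deriv h has_real_derivative d) (at x)"
    and "(deriv k has_real_derivative e) (at (h x))"
    using h(3) k(3) by (auto simp: real_differentiable_def)
  then show "(\<lambda>y. deriv k (h y) * deriv h y) differentiable (at x)"
    using DERIV_mult[OF DERIV_chain2[OF _ h(2)]] unfolding real_differentiable_def by blast
qed

lemma twice_differentiable_at_lincomb:
  assumes "twice_differentiable_at h x" and "twice_differentiable_at k x"
  shows "twice_differentiable_at (\<lambda>y. a * h y + b * k y) x"
proof (rule twice_differentiable_atI)
  note h = twice_differentiable_atD[OF assms(1)] and k = twice_differentiable_atD[OF assms(2)]
  from h(1) k(1) show "\<forall>\<^sub>F y in nhds x.
      ((\<lambda>y. a * h y + b * k y) has_real_derivative a * deriv h y + b * deriv k y) (at y)"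
    by eventually_elim (intro DERIV_add DERIV_cmult)
  show "(\<lambda>y. a * deriv h y + b * deriv k y) differentiable (at x)"
    using h(3) k(3) by (intro derivative_intros)
qed

lemma twice_differentiable_at_affine: "twice_differentiable_at (\<lambda>y. a * y + b) x"
  by (rule twice_differentiable_atI[where h' = "\<lambda>_. a"])
    (auto intro!: always_eventually derivative_eq_intros)

text \<open>Continuity of \<open>n\<close> is not presupposed: a continuous \<open>h\<close> with a
  left inverse on an open set is an open map there, which is what makes the inverse
  continuous.\<close>

lemma DERIV_inverse_function_strong:
  fixes h n :: "real \<Rightarrow> real"
  assumes "open S" "x \<in> S" "continuous_on S h" "\<And>y. y \<in> S \<Longrightarrow> n (h y) = y"
    and "(h has_real_derivative d) (at x)" "d \<noteq> 0"
  shows "(n has_real_derivative inverse d) (at (h x))"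
  unfolding has_field_derivative_def
  by (rule has_derivative_inverse_strong[OF assms(1-4)])
    (use assms(5,6) in \<open>auto simp: has_field_derivative_def fun_eq_iff\<close>)

text \<open>Near \<open>h x\<close> the derivative of \<open>n\<close> is the reciprocal of
  \<open>deriv h\<close> composed with \<open>n\<close>. This expression is differentiable at
  \<open>h x\<close> because \<open>deriv h\<close> is differentiable at \<open>x = n (h x)\<close>
  and \<open>n\<close> at \<open>h x\<close>.\<close>

lemma inverse_function_twice_differentiable:
  fixes h n :: "real \<Rightarrow> real"
  assumes h: "twice_differentiable_at h x" and nz: "deriv h x \<noteq> 0"
    and nh: "\<And>y. n (h y) = y" and hn: "\<And>z. h (n z) = z"
  shows "twice_differentiable_at n (h x)"
    and "(n has_real_derivative inverse (deriv h x)) (at (h x))"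
proof -
  note hD = twice_differentiable_atD[OF h]
  obtain S where S: "open S" "x \<in> S"
    and Sd: "\<And>y. y \<in> S \<Longrightarrow> (h has_real_derivative deriv h y) (at y)"
    using hD(1) unfolding eventually_nhds by auto
  have cont: "continuous_on S h"
    using S(1) Sd by (auto simp: continuous_on_eq_continuous_at intro: DERIV_isCont)
  have inv: "(n has_real_derivative inverse (deriv h y)) (at (h y))"
    if "y \<in> S" "deriv h y \<noteq> 0" for y
    using DERIV_inverse_function_strong[OF S(1) that(1) cont _ Sd[OF that(1)] that(2)] nh by auto
  show n1: "(n has_real_derivative inverse (deriv h x)) (at (h x))"
    using inv S(2) nz .
  have c: "isCont (deriv h) x"
    using hD(3) by (rule differentiable_imp_continuous_within)
  have "\<forall>\<^sub>F y in nhds x. y \<in> S \<and> deriv h y \<noteq> 0"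
    using eventually_nhds_in_open[OF S] eventually_nhds_isCont[OF c t1_space_nhds[OF nz]]
    by (rule eventually_conj)
  \<comment> \<open>The differentiability of \<open>n\<close> at \<open>h x\<close> just obtained
    gives its continuity there, which carries the condition on \<open>y\<close> near
    \<open>x\<close> over to \<open>n z\<close> for \<open>z\<close> near
    \<open>h x\<close>.\<close>
  then have "\<forall>\<^sub>F z in nhds (h x). n z \<in> S \<and> deriv h (n z) \<noteq> 0"
    using eventually_nhds_isCont[OF DERIV_isCont[OF n1]] by (simp add: nh)
  then have "\<forall>\<^sub>F z in nhds (h x). (n has_real_derivative inverse (deriv h (n z))) (at z)"
    \<comment> \<open>Here \<open>inv\<close> is applied at \<open>y = n z\<close>, where
      \<open>h y = z\<close>.\<close>
    by eventually_elim (use inv hn in metis)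
  moreover have "(\<lambda>z. inverse (deriv h (n z))) differentiable (at (h x))"
  proof -
    obtain d where "(deriv h has_real_derivative d) (at (n (h x)))"
      using hD(3) by (auto simp: real_differentiable_def nh)
    from DERIV_inverse_fun[OF DERIV_chain2[OF this n1]] nz show ?thesis
      unfolding real_differentiable_def nh by blast
  qed
  ultimately show "twice_differentiable_at n (h x)"
    by (rule twice_differentiable_atI)
qed

section \<open>Quadratic convergence of fixed-point iterations\<close>

lemma converges_quadratically_toI:
  assumes bound: "\<And>x. \<bar>x - l\<bar> < \<delta> \<Longrightarrow> \<bar>G x - l\<bar> \<le> C * \<bar>x - l\<bar>\<^sup>2" and "\<delta> > 0" "C > 0"
  shows "converges_quadratically_to G l"
proof -
  \<comment> \<open>Within radius \<open>1 / (2 * C)\<close> one factor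
    \<open>C * \<bar>x - l\<bar>\<close> of the quadratic bound is at most 1/2, so each step at
    least halves the error.\<close>
  define \<epsilon> where "\<epsilon> = min \<delta> (1 / (2 * C))"
  have "\<epsilon> > 0" using assms by (simp add: \<epsilon>_def)
  moreover have "(\<lambda>n. (G ^^ n) x0) \<longlonglongrightarrow> l \<and>
      (\<forall>n. \<bar>(G ^^ Suc n) x0 - l\<bar> \<le> C * \<bar>(G ^^ n) x0 - l\<bar>\<^sup>2)" if x0: "\<bar>x0 - l\<bar> < \<epsilon>" for x0
  proof -
    have half: "\<bar>G x - l\<bar> \<le> \<bar>x - l\<bar> / 2" if "\<bar>x - l\<bar> < \<epsilon>" for x
    proof -
      have "C * \<bar>x - l\<bar> \<le> 1 / 2"
        using that \<open>C > 0\<close> by (simp add: \<epsilon>_def field_simps)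
      then have "(C * \<bar>x - l\<bar>) * \<bar>x - l\<bar> \<le> (1 / 2) * \<bar>x - l\<bar>"
        by (rule mult_right_mono) simp
      moreover have "\<bar>G x - l\<bar> \<le> C * \<bar>x - l\<bar>\<^sup>2"
        using that by (intro bound) (simp add: \<epsilon>_def)
      ultimately show ?thesis
        by (simp only: power2_eq_square mult.assoc)
    qed
    \<comment> \<open>Both claims go through one induction: halving is available at the next step
      only while the iterate stays within \<open>\<epsilon>\<close> of \<open>l\<close>.\<close>
    have geom: "\<bar>(G ^^ n) x0 - l\<bar> \<le> (1/2) ^ n * \<bar>x0 - l\<bar>" and near: "\<bar>(G ^^ n) x0 - l\<bar> < \<epsilon>" for n
    proof (induction n)
      case 0
      case 1 show ?case by simp
      case 2 show ?case using x0 by simp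
    next
      case (Suc n)
      have *: "\<bar>(G ^^ Suc n) x0 - l\<bar> \<le> \<bar>(G ^^ n) x0 - l\<bar> / 2"
        using half[OF Suc(2)] by simp
      with Suc show "\<bar>(G ^^ Suc n) x0 - l\<bar> \<le> (1/2) ^ Suc n * \<bar>x0 - l\<bar>"
        by simp
      show "\<bar>(G ^^ Suc n) x0 - l\<bar> < \<epsilon>"
        by (rule le_less_trans[OF *]) (use Suc(2) abs_ge_zero[of "(G ^^ n) x0 - l"] in simp)
    qed
    have "(\<lambda>n. (1/2) ^ n * \<bar>x0 - l\<bar>) \<longlonglongrightarrow> 0 * \<bar>x0 - l\<bar>"
      by (intro tendsto_mult_right LIMSEQ_power_zero) simp
    then have "(\<lambda>n. (G ^^ n) x0 - l) \<longlonglongrightarrow> 0"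
      by (rule Lim_null_comparison[rotated, OF tendsto_eq_rhs])
        (use geom in \<open>auto intro!: always_eventually\<close>)
    moreover have "\<bar>(G ^^ Suc n) x0 - l\<bar> \<le> C * \<bar>(G ^^ n) x0 - l\<bar>\<^sup>2" for n
      using bound[of "(G ^^ n) x0"] near[of n] by (simp add: \<epsilon>_def)
    ultimately show ?thesis
      by (simp add: LIM_zero_iff)
  qed
  ultimately show ?thesis
    unfolding converges_quadratically_to_def by blast
qed

lemma superattracting_fixed_point_converges_quadratically:
  assumes "twice_differentiable_at G l" and fixed: "G l = l" and zero: "deriv G l = 0"
  shows "converges_quadratically_to G l"
proof -
  note G = twice_differentiable_atD[OF assms(1)]
  obtain d where "(deriv G has_real_derivative d) (at l)"
    using G(3) by (auto simp: real_differentiable_def)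
  then have "((\<lambda>y. deriv G y / (y - l)) \<longlongrightarrow> d) (at l)"
    by (simp add: has_field_derivative_iff zero)
  \<comment> \<open>Any positive tolerance would do; tolerance 1 around the limit \<open>d\<close>
    of the difference quotient gives the constant \<open>\<bar>d\<bar> + 1\<close>.\<close>
  from tendstoD[OF this zero_less_one]
  have "\<forall>\<^sub>F y in at l. dist (deriv G y / (y - l)) d < 1 \<and> y \<noteq> l"
    by (intro eventually_conj eventually_neq_at_within)
  then have "\<forall>\<^sub>F y in at l. \<bar>deriv G y\<bar> \<le> (\<bar>d\<bar> + 1) * \<bar>y - l\<bar>"
  proof eventually_elim
    case (elim y)
    then have "\<bar>deriv G y / (y - l)\<bar> \<le> \<bar>d\<bar> + 1"
      unfolding dist_real_def by linarith
    with elim show ?case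
      unfolding abs_divide by (simp add: pos_divide_le_eq)
  qed
  \<comment> \<open>At \<open>y = l\<close> itself both sides are 0, so the bound extends from the
    punctured neighbourhood to the full one.\<close>
  then have "\<forall>\<^sub>F y in nhds l. \<bar>deriv G y\<bar> \<le> (\<bar>d\<bar> + 1) * \<bar>y - l\<bar>"
    unfolding eventually_at_filter by eventually_elim (auto simp: zero)
  from eventually_conj[OF G(1) this] obtain \<delta> where "\<delta> > 0"
    and \<delta>: "\<And>y. \<bar>y - l\<bar> < \<delta> \<Longrightarrow> (G has_real_derivative deriv G y) (at y)"
      "\<And>y. \<bar>y - l\<bar> < \<delta> \<Longrightarrow> \<bar>deriv G y\<bar> \<le> (\<bar>d\<bar> + 1) * \<bar>y - l\<bar>"
    unfolding eventually_nhds_metric by (auto simp: dist_real_def)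
  show ?thesis
  proof (rule converges_quadratically_toI)
    show "\<delta> > 0" by fact
    show "\<bar>d\<bar> + 1 > 0" by simp
    fix x assume x: "\<bar>x - l\<bar> < \<delta>"
    have near: "\<bar>y - l\<bar> \<le> \<bar>x - l\<bar>" if "y \<in> closed_segment l x" for y
      using segment_bound1[OF that] by (simp add: abs_minus_commute)
    \<comment> \<open>On the segment from \<open>l\<close> to \<open>x\<close> the derivative is
      bounded by its bound at the far end; the mean value inequality supplies the second factor
      \<open>\<bar>x - l\<bar>\<close>.\<close>
    have "norm (G x - G l) \<le> ((\<bar>d\<bar> + 1) * \<bar>x - l\<bar>) * norm (x - l)"
    proof (rule field_differentiable_bound[where S = "closed_segment l x" and f' = "deriv G"])
      fix y assume y: "y \<in> closed_segment l x"
      show "(G has_real_derivative deriv G y) (at y within closed_segment l x)"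
        using near[OF y] x by (auto intro!: has_field_derivative_at_within[OF \<delta>(1)])
      have "\<bar>deriv G y\<bar> \<le> (\<bar>d\<bar> + 1) * \<bar>y - l\<bar>"
        using \<delta>(2)[of y] near[OF y] x by auto
      also have "\<dots> \<le> (\<bar>d\<bar> + 1) * \<bar>x - l\<bar>"
        using near[OF y] by (intro mult_left_mono) auto
      finally show "norm (deriv G y) \<le> (\<bar>d\<bar> + 1) * \<bar>x - l\<bar>" by simp
    qed auto
    then show "\<bar>G x - l\<bar> \<le> (\<bar>d\<bar> + 1) * \<bar>x - l\<bar>\<^sup>2"
      by (simp add: fixed power2_eq_square mult.assoc)
  qed
qed

text \<open>The analytic core, free of the differential equation: \<open>D1\<close> and
  \<open>D2\<close> stand for the two Dirichlet-to-Neumann maps, \<open>N\<close> for the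
  Neumann-to-Dirichlet map of the second subdomain, and \<open>balance\<close> for the cancellation
  of the outward fluxes.\<close>

lemma relaxed_inverse_iteration_converges_quadratically:
  fixes D1 D2 N :: "real \<Rightarrow> real"
  assumes D1: "twice_differentiable_at D1 l" and D2: "twice_differentiable_at D2 l"
    and pos: "deriv D1 l * deriv D2 l > 0"
    and N: "\<And>y. N (D2 y) = y" "\<And>z. D2 (N z) = z"
    and balance: "D1 l + D2 l = 0"
  shows "\<exists>\<theta>. 0 < \<theta> \<and> \<theta> < 1 \<and>
    converges_quadratically_to (\<lambda>x. (1 - \<theta>) * x + \<theta> * N (- D1 x)) l"
proof -
  let ?d1 = "deriv D1 l" and ?d2 = "deriv D2 l"
  define \<theta> where "\<theta> = ?d2 / (?d1 + ?d2)"
  have nz: "?d2 \<noteq> 0" "?d1 + ?d2 \<noteq> 0"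
    using pos by (auto simp: zero_less_mult_iff)
  have bounds: "0 < \<theta>" "\<theta> < 1"
    using pos by (auto simp: \<theta>_def zero_less_mult_iff field_simps)
  have D2l: "D2 l = - D1 l"
    using balance by simp
  \<comment> \<open>The inverse function facts concern \<open>N\<close> at \<open>D2 l\<close>; by
    the flux balance this is \<open>- D1 l\<close>, the point where the iteration map evaluates
    \<open>N\<close>.\<close>
  note NI = inverse_function_twice_differentiable[OF D2 nz(1) N, unfolded D2l]
  let ?G = "\<lambda>x. (1 - \<theta>) * x + \<theta> * N (- D1 x)"
  have neg: "twice_differentiable_at (\<lambda>x. - D1 x) l"
    using twice_differentiable_at_compose[OF D1 twice_differentiable_at_affine[of "-1" 0]] by simp
  have "twice_differentiable_at ?G l"
    using twice_differentiable_at_affine[of 1 0 l] twice_differentiable_at_compose[OF neg NI(1)]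
    by (intro twice_differentiable_at_lincomb) simp_all
  moreover have "?G l = l"
    using N(1)[of l] by (simp add: D2l algebra_simps)
  moreover have "deriv ?G l = 0"
  proof (rule DERIV_imp_deriv)
    have "(?G has_real_derivative (1 - \<theta>) * 1 + \<theta> * (inverse ?d2 * (- ?d1))) (at l)"
      using twice_differentiable_atD(2)[OF D1]
      by (intro DERIV_add DERIV_cmult DERIV_chain2[where f = N and g = "\<lambda>x. - D1 x", OF NI(2)]
          DERIV_minus DERIV_ident)
    also have "(1 - \<theta>) * 1 + \<theta> * (inverse ?d2 * (- ?d1)) = 0"
      using nz by (simp add: \<theta>_def field_simps)
    finally show "(?G has_real_derivative 0) (at l)" .
  qed
  ultimately have "converges_quadratically_to ?G l"
    by (rule superattracting_fixed_point_converges_quadratically)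
  with bounds show ?thesis by blast
qed

section \<open>Integrability and splitting of the load integral\<close>

text \<open>A continuous factor is bounded on the compact interval. Integrability must be secured
  because the integral of a non-integrable function is 0 by convention, and additivity could then
  fail.\<close>

lemma set_integrable_mult_continuous:
  fixes f h :: "real \<Rightarrow> real"
  assumes f: "set_integrable lborel {a<..<b} f" and h: "continuous_on {a..b} h"
  shows "set_integrable lborel {a<..<b} (\<lambda>x. f x * h x)"
proof -
  obtain B where B: "\<And>x. x \<in> {a..b} \<Longrightarrow> \<bar>h x\<bar> \<le> B"
    using compact_imp_bounded[OF compact_continuous_image[OF h compact_Icc]]
    unfolding bounded_iff real_norm_def by blast
  have [measurable]: "(\<lambda>x. indicator {a<..<b} x *\<^sub>R h x) \<in> borel_measurable lborel"
    using borel_measurable_continuous_on_indicator[OF _ continuous_on_subset[OF h, of "{a<..<b}"]]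
    by (simp add: greaterThanLessThan_subseteq_atLeastAtMost_iff)
  have [measurable]: "(\<lambda>x. indicator {a<..<b} x *\<^sub>R f x) \<in> borel_measurable lborel"
    using f by (simp add: set_integrable_def)
  have eq: "(\<lambda>x. indicator {a<..<b} x *\<^sub>R (f x * h x)) =
      (\<lambda>x. (indicator {a<..<b} x *\<^sub>R f x) * (indicator {a<..<b} x *\<^sub>R h x))"
    by (auto simp: fun_eq_iff indicator_def)
  have "integrable lborel (\<lambda>x. (indicator {a<..<b} x *\<^sub>R f x) * (indicator {a<..<b} x *\<^sub>R h x))"
  proof (rule Bochner_Integration.integrable_bound)
    show "integrable lborel (\<lambda>x. B * (indicator {a<..<b} x *\<^sub>R f x))"
      using f by (simp add: set_integrable_def)
    have "\<bar>f x\<bar> * \<bar>h x\<bar> \<le> \<bar>B\<bar> * \<bar>f x\<bar>" if "x \<in> {a<..<b}" for x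
      using B[of x] that by (subst mult.commute) (intro mult_right_mono, auto)
    then show "AE x in lborel. norm ((indicator {a<..<b} x *\<^sub>R f x) * (indicator {a<..<b} x *\<^sub>R h x))
        \<le> norm (B * (indicator {a<..<b} x *\<^sub>R f x))"
      by (intro always_eventually allI) (auto simp: indicator_def abs_mult)
  qed measurable
  then show ?thesis
    unfolding set_integrable_def eq .
qed

text \<open>The two open pieces miss only the point \<open>c\<close>, which is a null set.\<close>

lemma set_integral_Ioo_split:
  fixes f :: "real \<Rightarrow> real"
  assumes "a < c" "c < b" and f: "set_integrable lborel {a<..<b} f"
  shows "(LINT x:{a<..<b}|lborel. f x) = (LINT x:{a<..<c}|lborel. f x) + (LINT x:{c<..<b}|lborel. f x)"
proof -
  have sub: "set_integrable lborel {a<..<c} f" "set_integrable lborel {c<..<b} f"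
    using assms by (auto intro!: set_integrable_subset[OF f])
  have sing: "set_integrable lborel {c} f" "(LINT x:{c}|lborel. f x) = 0"
    using assms(1,2) set_integrable_subset[OF f, of "{c}"]
    by (auto simp: set_lebesgue_integral_def intro!: integral_eq_zero_AE AE_I[of _ _ "{c}"]
        split: split_indicator_asm)
  have "{a<..<b} = ({a<..<c} \<union> {c}) \<union> {c<..<b}"
    using assms(1,2) by auto
  moreover have "set_integrable lborel ({a<..<c} \<union> {c}) f"
    using assms by (auto intro!: set_integrable_subset[OF f])
  then have "(LINT x:({a<..<c} \<union> {c}) \<union> {c<..<b}|lborel. f x) =
      (LINT x:{a<..<c}|lborel. f x) + (LINT x:{c<..<b}|lborel. f x)"
    using sub sing by (subst set_integral_Un; (subst set_integral_Un)?; auto)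
  ultimately show ?thesis by simp
qed

section \<open>Traces, weak forms, loads and fluxes on two subdomains\<close>

locale dn_setting =
  fixes P :: "'x::{real_inner,complete_space} dn_problem" and f g :: "real \<Rightarrow> real"
  assumes space: "hilbert_function_space P"
    and operator: "local_operator P"
    and posed: "well_posed P f g"
begin

abbreviation "\<Gamma> \<equiv> iface P"
abbreviation "\<psi> \<equiv> sub_data P f g"

lemma order: "lend P < \<Gamma>" "\<Gamma> < rend P"
  using space by (auto simp: hilbert_function_space_def)

lemma closure_dom: "closure (dom P) = {lend P..rend P}"
  using order by (simp add: dom_def)

lemma frontier_dom: "frontier (dom P) = {lend P, rend P}"
  using order by (auto simp: frontier_def dom_def interior_open)

lemma frontier_sub: "frontier (sub P j) = insert \<Gamma> (outer P j)"
  using order by (cases j) (auto simp: outer_def frontier_def interior_open)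

lemma outer_simps [simp]: "outer P Sub1 = {lend P}" "outer P Sub2 = {rend P}"
  using order by (auto simp: outer_def frontier_def interior_open)

lemma sub_subset: "sub P j \<subseteq> dom P" "closure (sub P j) \<subseteq> closure (dom P)"
  using order by (cases j; auto simp: dom_def)+

lemma boundary_in_closure: "\<Gamma> \<in> closure (sub P j)" "outer P j \<subseteq> closure (sub P j)"
  using order by (cases j; simp)+

lemma outer_subset_frontier: "outer P j \<subseteq> frontier (dom P)"
  by (cases j) (simp_all add: frontier_dom)

lemma ev_bounded_linear: "x \<in> closure (dom P) \<Longrightarrow> bounded_linear (\<lambda>u. ev P u x)"
  using space by (simp add: hilbert_function_space_def)

lemma ev_linear_simps:
  assumes "x \<in> closure (dom P)"
  shows "ev P 0 x = 0" "ev P (u - c *\<^sub>R w) x = ev P u x - c * ev P w x"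
proof -
  interpret bounded_linear "\<lambda>u. ev P u x" using assms by (rule ev_bounded_linear)
  show "ev P 0 x = 0" "ev P (u - c *\<^sub>R w) x = ev P u x - c * ev P w x"
    by (simp_all add: zero diff scaleR)
qed

lemma ev_continuous: "continuous_on {lend P..rend P} (ev P u)"
  using space by (simp add: hilbert_function_space_def closure_dom)

lemma glue:
  assumes "ev P u1 \<Gamma> = ev P u2 \<Gamma>"
  obtains w where "\<And>x. x \<in> closure (sub P Sub1) \<Longrightarrow> ev P w x = ev P u1 x"
    and "\<And>x. x \<in> closure (sub P Sub2) \<Longrightarrow> ev P w x = ev P u2 x"
  using assms space unfolding hilbert_function_space_def by metis

text \<open>This test function isolates the flux: it is admissible on all of the domain and has
  trace 1 at the interface.\<close>

lemma hat:
  obtains v where "\<And>x. x \<in> frontier (dom P) \<Longrightarrow> ev P v x = 0" and "ev P v \<Gamma> = 1"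
  using space unfolding hilbert_function_space_def by metis

lemma wform_sub_linear: "bounded_linear (wform P (sub P j) u)"
  using operator by (cases j) (auto simp: local_operator_def)

lemma wform_sub_cong:
  assumes "\<And>x. x \<in> sub P j \<Longrightarrow> ev P u x = ev P u' x" "\<And>x. x \<in> sub P j \<Longrightarrow> ev P v x = ev P v' x"
  shows "wform P (sub P j) u v = wform P (sub P j) u' v'"
proof -
  have "sub P j \<in> {dom P, sub P Sub1, sub P Sub2}"
    by (cases j) auto
  then show ?thesis
    using operator assms unfolding local_operator_def by blast
qed

lemma wform_dom: "wform P (dom P) u v = wform P (sub P Sub1) u v + wform P (sub P Sub2) u v"
  using operator by (simp add: local_operator_def)

lemma integrable_load: "set_integrable lborel (dom P) (\<lambda>x. f x * ev P v x)"
  using set_integrable_mult_continuous[OF _ ev_continuous] posed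
  by (simp add: well_posed_def dom_def)

lemma integrable_load_sub: "set_integrable lborel (sub P j) (\<lambda>x. f x * ev P v x)"
  by (rule set_integrable_subset[OF integrable_load _ sub_subset(1)]) (cases j; simp)

lemma load_sub_cong:
  assumes "\<And>x. x \<in> sub P j \<Longrightarrow> ev P v x = ev P v' x"
  shows "load P (sub P j) h v = load P (sub P j) h v'"
  unfolding load_def using assms by (intro set_lebesgue_integral_cong) (cases j; auto)+

lemma load_dom: "load P (dom P) f v = load P (sub P Sub1) f v + load P (sub P Sub2) f v"
  using set_integral_Ioo_split[OF order] integrable_load[unfolded dom_def]
  by (simp add: load_def dom_def)

lemma load_sub_diff_scaleR:
  "load P (sub P j) f (u - c *\<^sub>R w) = load P (sub P j) f u - c * load P (sub P j) f w"
proof -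
  have "load P (sub P j) f (u - c *\<^sub>R w) =
      (LINT x:sub P j|lborel. f x * ev P u x - c * (f x * ev P w x))"
    unfolding load_def
  proof (rule set_lebesgue_integral_cong)
    show "sub P j \<in> sets lborel" by (cases j) auto
    show "\<forall>x. x \<in> sub P j \<longrightarrow>
        f x * ev P (u - c *\<^sub>R w) x = f x * ev P u x - c * (f x * ev P w x)"
      using sub_subset(1)[of j] closure_subset[of "dom P"]
      by (auto simp: ev_linear_simps algebra_simps)
  qed
  also have "\<dots> = load P (sub P j) f u - c * load P (sub P j) f w"
    unfolding load_def
    by (subst set_integral_diff(2)) (simp_all only: integrable_load_sub set_integrable_mult_right set_integral_mult_right)
  finally show ?thesis .
qed

lemma load_data: "load P (sub P j) (fst (\<psi> j)) = load P (sub P j) f"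
  unfolding load_def sub_data_def fst_conv
  by (intro ext set_lebesgue_integral_cong) (cases j; auto)+

lemma neumann_data: "neumann P j (fst (\<psi> j)) = neumann P j f"
  by (simp add: neumann_def load_data fun_eq_iff)

lemma solves_in_data: "solves_in P (sub P j) (fst (\<psi> j)) = solves_in P (sub P j) f"
  by (simp add: solves_in_def load_data fun_eq_iff)

text \<open>Locality of the weak form makes the flux independent of how a subdomain solution is
  extended to the other side.\<close>

lemma neumann_cong:
  assumes "\<And>x. x \<in> sub P j \<Longrightarrow> ev P u x = ev P u' x"
  shows "neumann P j h u = neumann P j h u'"
  using wform_sub_cong[OF assms] by (simp add: neumann_def)

text \<open>Subtracting a multiple of a function with trace 1 at \<open>\<Gamma>\<close> turns any test function into one that
  vanishes on the whole boundary of the subdomain.\<close>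

lemma neumann_flux:
  assumes u: "solves_in P (sub P j) f u" and v: "\<And>x. x \<in> outer P j \<Longrightarrow> ev P v x = 0"
  shows "wform P (sub P j) u v = load P (sub P j) f v + neumann P j f u * ev P v \<Gamma>"
proof -
  obtain e where e: "\<And>x. x \<in> frontier (dom P) \<Longrightarrow> ev P e x = 0" "ev P e \<Gamma> = 1"
    using hat by blast
  have eo: "ev P e x = 0" if "x \<in> outer P j" for x
    using that e(1) outer_subset_frontier by blast
  \<comment> \<open>The coefficient is forced: testing with \<open>e\<close>, whose trace at
    \<open>\<Gamma>\<close> is 1, leaves exactly \<open>q\<close>.\<close>
  define q where "q = wform P (sub P j) u e - load P (sub P j) f e"
  have flux: "wform P (sub P j) u v = load P (sub P j) f v + q * ev P v \<Gamma>"
    if v: "\<forall>x\<in>outer P j. ev P v x = 0" for v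
  proof -
    let ?w = "v - ev P v \<Gamma> *\<^sub>R e"
    have "ev P ?w x = 0" if "x \<in> frontier (sub P j)" for x
    proof -
      have "x \<in> closure (dom P)"
        using that boundary_in_closure[of j] sub_subset(2)[of j] by (auto simp: frontier_sub)
      then show ?thesis
        using that v e(2) eo by (auto simp: ev_linear_simps frontier_sub)
    qed
    then have *: "wform P (sub P j) u ?w = load P (sub P j) f ?w"
      using u by (simp add: solves_in_def)
    interpret bounded_linear "wform P (sub P j) u" by (rule wform_sub_linear)
    from * show ?thesis
      by (simp add: load_sub_diff_scaleR diff scaleR q_def algebra_simps)
  qed
  have "neumann P j f u = q"
    unfolding neumann_def
  proof (rule the_equality)
    show "\<forall>v. (\<forall>x\<in>outer P j. ev P v x = 0) \<longrightarrow>
        wform P (sub P j) u v = load P (sub P j) f v + q * ev P v \<Gamma>"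
      using flux by blast
  next
    fix q' assume "\<forall>v. (\<forall>x\<in>outer P j. ev P v x = 0) \<longrightarrow>
        wform P (sub P j) u v = load P (sub P j) f v + q' * ev P v \<Gamma>"
    with eo e(2) have "wform P (sub P j) u e = load P (sub P j) f e + q'" by simp
    then show "q' = q" by (simp add: q_def)
  qed
  with flux v show ?thesis by simp
qed

section \<open>The interface operators as mutual inverses\<close>

text \<open>The description in \<open>DtN\<close> is definite because two Dirichlet solutions agree
  on the subdomain, and the flux sees nothing else.\<close>

lemma DtN_eq:
  assumes u: "dirichlet_sol P j lam (\<psi> j) u"
  shows "DtN P j lam (\<psi> j) = neumann P j f u"
  unfolding DtN_def neumann_data
proof (rule the_equality)
  show "\<exists>w. dirichlet_sol P j lam (\<psi> j) w \<and> neumann P j f w = neumann P j f u"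
    using u by blast
next
  fix q assume "\<exists>w. dirichlet_sol P j lam (\<psi> j) w \<and> neumann P j f w = q"
  then obtain w where w: "dirichlet_sol P j lam (\<psi> j) w" "neumann P j f w = q" by blast
  have "ev P w x = ev P u x" if "x \<in> sub P j" for x
    using posed u w(1) that closure_subset[of "sub P j"]
    unfolding well_posed_def unique_on_def by blast
  from neumann_cong[OF this] w(2) show "q = neumann P j f u" by simp
qed

text \<open>Neumann solutions agree on the closed subdomain, which contains \<open>\<Gamma>\<close>,
  so their traces coincide.\<close>

lemma NtD_eq:
  assumes v: "neumann_sol P j \<phi> (\<psi> j) v"
  shows "NtD P j \<phi> (\<psi> j) = ev P v \<Gamma>"
  unfolding NtD_def
proof (rule the_equality)
  show "\<exists>w. neumann_sol P j \<phi> (\<psi> j) w \<and> ev P w \<Gamma> = ev P v \<Gamma>"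
    using v by blast
next
  fix l assume "\<exists>w. neumann_sol P j \<phi> (\<psi> j) w \<and> ev P w \<Gamma> = l"
  then show "l = ev P v \<Gamma>"
    using posed v boundary_in_closure(1)[of j] unfolding well_posed_def unique_on_def by blast
qed

text \<open>A Dirichlet solution is also a Neumann solution for its own flux.\<close>

lemma NtD_DtN: "NtD P j (DtN P j lam (\<psi> j)) (\<psi> j) = lam"
proof -
  obtain u where u: "dirichlet_sol P j lam (\<psi> j) u"
    using posed unfolding well_posed_def unique_on_def by blast
  then have "neumann_sol P j (DtN P j lam (\<psi> j)) (\<psi> j) u"
    by (simp add: DtN_eq neumann_sol_def dirichlet_sol_def neumann_data)
  with u show ?thesis
    by (simp add: NtD_eq dirichlet_sol_def)
qed

lemma DtN_NtD: "DtN P j (NtD P j \<phi> (\<psi> j)) (\<psi> j) = \<phi>"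
proof -
  obtain v where v: "neumann_sol P j \<phi> (\<psi> j) v"
    using posed unfolding well_posed_def unique_on_def by blast
  then have "dirichlet_sol P j (NtD P j \<phi> (\<psi> j)) (\<psi> j) v"
    by (simp add: NtD_eq neumann_sol_def dirichlet_sol_def)
  with v show ?thesis
    by (simp add: DtN_eq neumann_sol_def neumann_data)
qed

section \<open>Flux balance of the exact solution\<close>

text \<open>A test function on one subdomain vanishes at \<open>\<Gamma>\<close>, so it can be glued
  to zero on the other side. The result is admissible on the whole domain, and by locality the other
  side contributes nothing.\<close>

lemma solves_in_dom_imp_sub:
  assumes u: "solves_in P (dom P) f u"
  shows "solves_in P (sub P j) f u"
  unfolding solves_in_def
proof (intro allI impI)
  fix v assume "\<forall>x\<in>frontier (sub P j). ev P v x = 0"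
  then have v: "ev P v \<Gamma> = 0" "\<And>x. x \<in> outer P j \<Longrightarrow> ev P v x = 0"
    by (auto simp: frontier_sub)
  have ev0: "ev P 0 x = 0" if "x \<in> closure (sub P i)" for x i
    using that sub_subset(2) ev_linear_simps(1) by blast
  define part where "part i = (if i = j then v else 0)" for i
  have "ev P (part Sub1) \<Gamma> = ev P (part Sub2) \<Gamma>"
    using v(1) ev0[OF boundary_in_closure(1)] by (simp add: part_def)
  then obtain w where "\<And>x. x \<in> closure (sub P Sub1) \<Longrightarrow> ev P w x = ev P (part Sub1) x"
    and "\<And>x. x \<in> closure (sub P Sub2) \<Longrightarrow> ev P w x = ev P (part Sub2) x"
    by (rule glue) blast
  then have w: "ev P w x = ev P (part i) x" if "x \<in> closure (sub P i)" for i x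
    using that by (cases i) blast+
  have wo: "ev P w x = 0" if "x \<in> outer P i" for i x
    using w[of x i] that boundary_in_closure(2)[of i] v(2) ev0[of x i]
    by (auto simp: part_def split: if_splits)
  have "\<forall>x\<in>frontier (dom P). ev P w x = 0"
    using wo[of _ Sub1] wo[of _ Sub2] by (simp add: frontier_dom)
  then have eq: "wform P (dom P) u w = load P (dom P) f w"
    using u by (simp add: solves_in_def)
  have wi: "wform P (sub P i) u w = wform P (sub P i) u (part i)"
    and li: "load P (sub P i) f w = load P (sub P i) f (part i)" for i
    using w closure_subset[of "sub P i"] by (blast intro: wform_sub_cong load_sub_cong)+
  have w0: "wform P (sub P i) u 0 = 0" for i
    using bounded_linear.linear[OF wform_sub_linear] by (rule linear_0)
  have l0: "load P (sub P i) f 0 = 0" for i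
    \<comment> \<open>The instance reads \<open>load 0 = load 0 - load 0\<close>.\<close>
    using load_sub_diff_scaleR[of i 0 1 0] by simp
  show "wform P (sub P j) u v = load P (sub P j) f v"
    using eq unfolding wform_dom load_dom wi li
    by (cases j) (simp_all add: part_def w0 l0 del: sub.simps)
qed

text \<open>Testing with the hat function, the two subdomain identities add up to the equation on
  the whole domain plus the sum of the two fluxes, which must therefore vanish.\<close>

lemma flux_balance:
  "DtN P Sub1 (lambda_ex P f g) (\<psi> Sub1) + DtN P Sub2 (lambda_ex P f g) (\<psi> Sub2) = 0"
proof -
  let ?u = "u_ex P f g"
  have "weak_solution P f g ?u"
    unfolding u_ex_def by (rule theI') (use posed in \<open>simp add: well_posed_def\<close>)
  then have u: "solves_in P (dom P) f ?u" "\<And>x. x \<in> frontier (dom P) \<Longrightarrow> ev P ?u x = g x"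
    by (simp_all add: weak_solution_def)
  note sol = solves_in_dom_imp_sub[OF u(1)]
  \<comment> \<open>On each side the exact solution solves the Dirichlet problem with its own trace,
    so \<open>DtN\<close> there returns its flux.\<close>
  have "dirichlet_sol P j (lambda_ex P f g) (\<psi> j) ?u" for j
    using sol u(2) outer_subset_frontier[of j]
    unfolding dirichlet_sol_def solves_in_data by (auto simp: lambda_ex_def sub_data_def)
  then have D: "DtN P j (lambda_ex P f g) (\<psi> j) = neumann P j f ?u" for j
    by (rule DtN_eq)
  obtain e where e: "\<And>x. x \<in> frontier (dom P) \<Longrightarrow> ev P e x = 0" "ev P e \<Gamma> = 1"
    using hat by blast
  have "wform P (sub P j) ?u e = load P (sub P j) f e + neumann P j f ?u" for j
    using neumann_flux[OF sol, of j e] e outer_subset_frontier[of j] by auto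
  moreover have "wform P (dom P) ?u e = load P (dom P) f e"
    using u(1) e(1) by (simp add: solves_in_def)
  ultimately show ?thesis
    unfolding D wform_dom load_dom by (simp del: sub.simps)
qed

end

theorem theorem1:
  fixes P :: "'x::{real_inner,complete_space} dn_problem"
    and f g :: "real \<Rightarrow> real"
  assumes "hilbert_function_space P"
    and "local_operator P"
    and "well_posed P f g"
    and "\<And>j. twice_differentiable_at (\<lambda>lam. DtN P j lam (sub_data P f g j)) (lambda_ex P f g)"
    and "deriv (\<lambda>lam. DtN P Sub1 lam (sub_data P f g Sub1)) (lambda_ex P f g) *
         deriv (\<lambda>lam. DtN P Sub2 lam (sub_data P f g Sub2)) (lambda_ex P f g) > 0"
  shows "\<exists>\<theta>. 0 < \<theta> \<and> \<theta> < 1 \<and> converges_quadratically_to (DN_map P f g \<theta>) (lambda_ex P f g)"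
proof -
  interpret dn_setting P f g
    using assms(1-3) by unfold_locales
  show ?thesis
    unfolding DN_map_def
    using relaxed_inverse_iteration_converges_quadratically
      [OF assms(4)[of Sub1] assms(4)[of Sub2] assms(5) NtD_DtN DtN_NtD flux_balance] .
qed

end
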